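(* One has $a(\{8\})=[1]$, $a(\{9,10\})=[0,1]$, $a(\{11,\dots,14\})=[0,0,0,1]$, $a(\{15,16\})=[1,1]$, $a(\{17,\dots,20\})=[0,0,1,1]$, $a(\{28,\dots,31\})=[1,1,1,1]$. Moreover, $$a(\Gamma_{1,m,1})=[a(\Gamma_{3,m-1,1}),a(\Gamma_{2,m-1,1}),a(\Gamma_{1,m-1,1})]+[\underbrace{0,\dots,0}_{t_{m-2}-k_m+1},\underbrace{1,\dots,1}_{k_m-1}]\quad\text{for } m\ge 5,$$ $$a(\Gamma_{2,m,1})=[a(\Gamma_{3,m-2,1}),a(\Gamma_{2,m-2,1}),a(\Gamma_{1,m-2,1})]+[\underbrace{0,\dots,0}_{t_{m-3}-k_m+1},\underbrace{1,\dots,1}_{k_m-1}]\quad\text{for } m\ge 6,$$ $$a(\Gamma_{3,m,1})=[a(\Gamma_{3,m-3,1}),a(\Gamma_{2,m-3,1}),a(\Gamma_{1,m-3,1})]+[\underbrace{1,\dots,1}_{t_{m-4}-k_{m-3}+1},\underbrace{0,\dots,0}_{k_{m-3}-1}]\quad\text{for } m\ge 7.$$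
   Context: The Tribonacci sequence $\mathbb{T}$ is the fixed point beginning with $a$ of the substitution $\sigma(a)=ab,\ \sigma(b)=ac,\ \sigma(c)=a$; positions are numbered from $1$. For a nonempty factor $\omega$ of $\mathbb{T}$, $\omega_p$ denotes its $p$-th occurrence. The word $\omega_p\omega_{p+1}$ is a (repeated) square if $\omega_{p+1}$ begins immediately after $\omega_p$ ends. For $n\ge 1$, $a(n)$ is the number of pairs $(\omega,p)$ such that $\omega_p\omega_{p+1}$ is a square ending exactly at position $n$. The Tribonacci numbers are $t_m=|\sigma^m(a)|$ for $m\ge 0$ ($t_0=1,t_1=2,t_2=4,t_3=7$, $t_m=t_{m-1}+t_{m-2}+t_{m-3}$). The kernel numbers are $k_0=0$, $k_1=k_2=1$, $k_m=k_{m-1}+k_{m-2}+k_{m-3}-1$ for $m\ge 3$. For $m\ge 4$ define the sets of consecutive integers $$\Gamma_{1,m,1}=\left\{\tfrac{t_m+2t_{m-1}-t_{m-2}-1}{2},\dots,\tfrac{t_m+2t_{m-1}+t_{m-2}-3}{2}\right\},$$ $$\Gamma_{2,m,1}=\left\{\tfrac{-t_m+4t_{m-1}+t_{m-2}-1}{2},\dots,\tfrac{t_m+2t_{m-1}-t_{m-2}-3}{2}\right\},$$ $$\Gamma_{3,m,1}=\left\{\tfrac{t_m+t_{m-2}-1}{2},\dots,\tfrac{-t_m+4t_{m-1}+t_{m-2}-3}{2}\right\}.$$ For a set $\Gamma=\{i,i+1,\dots,j\}$ of consecutive integers, $a(\Gamma)$ is the vector $[a(i),a(i+1),\dots,a(j)]$.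 For vectors $u,v,w$, $[u,v,w]$ denotes their concatenation, and addition of vectors is componentwise. *)

theory Defs
  imports Main "HOL-Library.Stream"
begin

datatype letter = La | Lb | Lc

fun sigma_letter :: "letter \<Rightarrow> letter list" where
  "sigma_letter La = [La, Lb]"
| "sigma_letter Lb = [La, Lc]"
| "sigma_letter Lc = [La]"

definition sigma :: "letter list \<Rightarrow> letter list" where
  "sigma w = concat (map sigma_letter w)"

definition sigma_stream :: "letter stream \<Rightarrow> letter stream" where
  "sigma_stream s = flat (smap sigma_letter s)"

text \<open>Existence and uniqueness of this fixed point is proved below as \<open>ex1_tribonacci\<close>.\<close>

definition tribonacci :: "letter stream" where
  "tribonacci = (THE s. shd s = La \<and> sigma_stream s = s)"

definition trib :: "nat \<Rightarrow> nat" where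
  "trib m = length ((sigma ^^ m) [La])"

fun kernel_num :: "nat \<Rightarrow> int" where
  "kernel_num 0 = 0"
| "kernel_num (Suc 0) = 1"
| "kernel_num (Suc (Suc 0)) = 1"
| "kernel_num (Suc (Suc (Suc m))) =
     kernel_num (Suc (Suc m)) + kernel_num (Suc m) + kernel_num m - 1"

text \<open>Starting positions of the occurrences of a word; positions are numbered from 1,
  whereas streams are indexed from 0.\<close>

definition occurrences :: "letter list \<Rightarrow> nat set" where
  "occurrences w = {i. 1 \<le> i \<and> stake (length w) (sdrop (i - 1) tribonacci) = w}"

text \<open>The \<open>p\<close>-th occurrence of \<open>w\<close> (\<open>p\<close> counted from 1) starts at position \<open>i\<close>.\<close>

definition is_pth_occurrence :: "letter list \<Rightarrow> nat \<Rightarrow> nat \<Rightarrow> bool" where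
  "is_pth_occurrence w p i \<longleftrightarrow>
     i \<in> occurrences w \<and> card {j \<in> occurrences w. j \<le> i} = p"

text \<open>The last position of the square starting at position \<open>i\<close> is \<open>i + 2 * length w - 1\<close>.\<close>

definition is_square_ending_at :: "letter list \<Rightarrow> nat \<Rightarrow> nat \<Rightarrow> bool" where
  "is_square_ending_at w p n \<longleftrightarrow>
     (\<exists>i. is_pth_occurrence w p i \<and> is_pth_occurrence w (p + 1) (i + length w) \<and>
          n = i + 2 * length w - 1)"

text \<open>The set below is finite, see \<open>finite_squares_ending_at\<close>.\<close>

definition num_squares_ending_at :: "nat \<Rightarrow> nat" where
  "num_squares_ending_at n = card {(w, p). w \<noteq> [] \<and> is_square_ending_at w p n}"

definition num_squares_vec :: "nat set \<Rightarrow> nat list" where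
  "num_squares_vec G = map num_squares_ending_at (sorted_list_of_set G)"

text \<open>The interval endpoints are computed in the integers; the divisions by 2 are exact,
  see \<open>odd_trib_add\<close>, and for \<open>m \<ge> 4\<close> all endpoints are positive.\<close>

definition Gamma1 :: "nat \<Rightarrow> nat set" where
  "Gamma1 m =
     (let t = \<lambda>j. int (trib j)
      in {nat ((t m + 2 * t (m - 1) - t (m - 2) - 1) div 2) ..
          nat ((t m + 2 * t (m - 1) + t (m - 2) - 3) div 2)})"

definition Gamma2 :: "nat \<Rightarrow> nat set" where
  "Gamma2 m =
     (let t = \<lambda>j. int (trib j)
      in {nat ((- t m + 4 * t (m - 1) + t (m - 2) - 1) div 2) ..
          nat ((t m + 2 * t (m - 1) - t (m - 2) - 3) div 2)})"

definition Gamma3 :: "nat \<Rightarrow> nat set" where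
  "Gamma3 m =
     (let t = \<lambda>j. int (trib j)
      in {nat ((t m + t (m - 2) - 1) div 2) ..
          nat ((- t m + 4 * t (m - 1) + t (m - 2) - 3) div 2)})"

text \<open>\<open>w = u + v\<close> as vectors. Equality of lengths is demanded explicitly because
  \<^const>\<open>zip\<close> silently truncates to the shorter list.\<close>

definition is_vec_sum :: "nat list \<Rightarrow> nat list \<Rightarrow> nat list \<Rightarrow> bool" where
  "is_vec_sum w u v \<longleftrightarrow> length u = length v \<and> w = map2 (+) u v"


lemma sigma_append: "sigma (u @ v) = sigma u @ sigma v"
  by (simp add: sigma_def)

lemma sigma_letter_nonempty: "sigma_letter x \<noteq> []"
  by (cases x) auto

lemma sigma_stream_shift: "sigma_stream (w @- s) = sigma w @- sigma_stream s"
proof (induction w)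
  case Nil
  then show ?case by (simp add: sigma_def)
next
  case (Cons x w)
  have "sigma_stream (x ## (w @- s)) = sigma_letter x @- sigma_stream (w @- s)"
    by (simp add: sigma_stream_def flat_Stream sigma_letter_nonempty)
  with Cons show ?case by (simp add: sigma_def)
qed

lemma stake_sigma_stream:
  "stake (length (sigma (stake n s))) (sigma_stream s) = sigma (stake n s)"
  by (metis append_Nil2 diff_self_eq_0 stake.simps(1) sigma_stream_shift stake_sdrop stake_shift
      take_all order_refl)

lemma sigma_pow_prefix: "\<exists>v. (sigma ^^ Suc m) [La] = (sigma ^^ m) [La] @ v"
proof (induction m)
  case 0
  then show ?case by (simp add: sigma_def)
next
  case (Suc m)
  then obtain v where "(sigma ^^ Suc m) [La] = (sigma ^^ m) [La] @ v" by blast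
  then have "sigma ((sigma ^^ Suc m) [La]) = sigma ((sigma ^^ m) [La]) @ sigma v"
    by (simp add: sigma_append)
  then show ?case by auto
qed

lemma trib_rec: "trib (Suc (Suc (Suc m))) = trib (Suc (Suc m)) + trib (Suc m) + trib m"
proof -
  have "(sigma ^^ m) (sigma (sigma (sigma [La]))) =
    (sigma ^^ m) (sigma (sigma [La])) @ (sigma ^^ m) (sigma [La]) @ (sigma ^^ m) [La]"
  proof (induction m)
    case 0
    then show ?case by (simp add: sigma_def)
  next
    case (Suc m)
    then show ?case by (simp add: sigma_append)
  qed
  then show ?thesis by (simp only: trib_def funpow_Suc_right o_apply length_append add.assoc)
qed

lemma trib_init: "trib 0 = 1" "trib (Suc 0) = 2" "trib (Suc (Suc 0)) = 4"
  by (simp_all add: trib_def sigma_def)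

lemma trib_gt: "m < trib m"
proof (induction m rule: kernel_num.induct)
  case (4 m)
  then show ?case by (simp add: trib_rec)
qed (simp_all add: trib_init)

lemma ex1_tribonacci: "\<exists>!s. shd s = La \<and> sigma_stream s = s"
proof -
  have pre: "stake (trib m) s = (sigma ^^ m) [La]"
    if "shd s = La" "sigma_stream s = s" for s m
  proof (induction m)
    case 0
    then show ?case using that(1) by (simp add: trib_init)
  next
    case (Suc m)
    then show ?case using stake_sigma_stream[of "trib m" s] that(2) by (simp add: trib_def)
  qed
  have uniq: "s !! i = (sigma ^^ m) [La] ! i"
    if "shd s = La" "sigma_stream s = s" "i < trib m" for s m i
    using pre[OF that(1,2), of m] stake_nth[OF that(3), of s] by simp
  define s where "s = smap (\<lambda>i. (sigma ^^ i) [La] ! i) nats"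
  have mono: "(sigma ^^ (m + d)) [La] ! i = (sigma ^^ m) [La] ! i" if "i < trib m" for m d i
  proof (induction d)
    case (Suc d)
    have "trib m \<le> trib (m + d)"
    proof (induction d)
      case (Suc d)
      obtain v where "(sigma ^^ Suc (m + d)) [La] = (sigma ^^ (m + d)) [La] @ v"
        using sigma_pow_prefix by blast
      then have "trib (m + d) \<le> trib (Suc (m + d))" by (simp add: trib_def)
      with Suc show ?case by simp
    qed simp
    moreover obtain v where "(sigma ^^ Suc (m + d)) [La] = (sigma ^^ (m + d)) [La] @ v"
      using sigma_pow_prefix by blast
    ultimately show ?case using Suc that by (simp add: nth_append trib_def)
  qed simp
  have nth: "s !! i = (sigma ^^ m) [La] ! i" if "i < trib m" for i m
  proof -
    have "(sigma ^^ (i + m)) [La] ! i = (sigma ^^ i) [La] ! i" by (rule mono[OF trib_gt])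
    moreover have "(sigma ^^ (m + i)) [La] ! i = (sigma ^^ m) [La] ! i" by (rule mono[OF that])
    ultimately show ?thesis by (simp add: s_def add.commute)
  qed
  have st: "stake (trib m) s = (sigma ^^ m) [La]" for m
    by (rule nth_equalityI) (simp_all add: trib_def nth[unfolded trib_def])
  have "sigma_stream s !! i = s !! i" for i
  proof -
    have i: "i < trib (Suc i)" using trib_gt[of "Suc i"] by simp
    have "stake (trib (Suc i)) (sigma_stream s) = (sigma ^^ Suc i) [La]"
      using stake_sigma_stream[of "trib i" s] unfolding st by (simp add: trib_def)
    then show ?thesis using st[of "Suc i"] i by (metis stake_nth)
  qed
  then have fp: "sigma_stream s = s"
    by (metis diff_Suc_1 ext stream_smap_nats[of "sigma_stream s"] stream_smap_nats[of s])
  have hd: "shd s = La" using nth[of 0 0] by (simp add: trib_init)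
  show ?thesis
  proof (rule ex1I[of _ s])
    show "shd s = La \<and> sigma_stream s = s" using hd fp by blast
  next
    fix r assume r: "shd r = La \<and> sigma_stream r = r"
    have "r !! i = s !! i" for i
      using uniq[of r i i] uniq[of s i i] r hd fp trib_gt[of i] by simp
    then show "r = s"
      by (metis ext stream_smap_nats)
  qed
qed

lemma odd_trib_add: "odd (trib (Suc (Suc m)) + trib m)"
proof (induction m rule: nat_less_induct)
  case (1 m)
  show ?case
  proof (cases m)
    case (Suc j)
    with 1 have "odd (trib (Suc (Suc j)) + trib j)" by simp
    then show ?thesis unfolding Suc trib_rec by (simp; presburger)
  qed (simp add: trib_init)
qed

text \<open>The two bounds below make the block lengths \<open>trib (m - 3) - kernel_num m + 1\<close> and \<open>kernel_num m - 1\<close>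
  nonnegative, so converting them to natural numbers loses nothing.\<close>

lemma kernel_num_ge_1: "1 \<le> kernel_num (Suc m)"
proof (induction m rule: kernel_num.induct)
  case (3)
  then show ?case by (simp add: numeral_eq_Suc)
next
  case (4 m)
  then show ?case by (simp only: kernel_num.simps)
qed simp_all

lemma kernel_num_le_trib: "kernel_num (m + 3) \<le> int (trib m)"
proof (induction m rule: kernel_num.induct)
  case (4 m)
  then show ?case by (simp add: trib_rec numeral_eq_Suc)
qed (simp_all add: trib_init numeral_eq_Suc)

lemma finite_squares_ending_at: "finite {(w, p). w \<noteq> [] \<and> is_square_ending_at w p n}"
proof -
  define f where "f = (\<lambda>(i, l). let w = stake l (sdrop (i - 1) tribonacci)
    in (w, card {j \<in> occurrences w. j \<le> i}))"
  have "{(w, p). w \<noteq> [] \<and> is_square_ending_at w p n} \<subseteq> f ` ({..n + 1} \<times> {..n + 1})"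
  proof (clarify)
    fix w p assume w: "w \<noteq> []" "is_square_ending_at w p n"
    then obtain i where i: "is_pth_occurrence w p i" "n = i + 2 * length w - 1"
      by (auto simp: is_square_ending_at_def)
    then have "(w, p) = f (i, length w)"
      by (simp add: f_def Let_def is_pth_occurrence_def occurrences_def)
    moreover have "(i, length w) \<in> {..n + 1} \<times> {..n + 1}" using i(2) by auto
    ultimately show "(w, p) \<in> f ` ({..n + 1} \<times> {..n + 1})" by blast
  qed
  then show ?thesis by (rule finite_subset) simp
qed

end

theory Submission
  imports Defs
begin

text \<open>
  Every block \<open>\<sigma>(x)\<close> begins with its only letter \<open>a\<close>, so each occurrence of a factor containing \<open>a\<close>
  is cut into blocks in the same way. Hence a maximal repetition of the Tribonacci word is the image
  of a shorter one, and going back to the empty word shows: the repetitions whose exponent is large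
  enough to contain a square are exactly those with period word \<open>\<sigma>\<^sup>k(x)\<close>, \<open>x\<close> the letter at some position
  \<open>y\<close>, in which the matching word is \<open>z\<^sub>k\<close>, where \<open>z\<^sub>0\<close> is empty and
  \<open>z\<^sub>k\<^sub>+\<^sub>1 = \<sigma>(z\<^sub>k) a\<close>. As \<open>|z\<^sub>k| = t\<^sub>0 + \<dots> + t\<^sub>k\<^sub>-\<^sub>1\<close> is less than three periods, there are no fourth powers;
  so a square in the sense of consecutive occurrences is just a square, and \<open>a(n)\<close> counts the periods
  of squares ending at \<open>n\<close>.

  The three sets \<open>\<Gamma>\<close> of index \<open>m\<close> partition \<open>|z\<^sub>m\<^sub>-\<^sub>1| < n \<le> |z\<^sub>m|\<close>, and the claim compares \<open>a(n)\<close> with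
  \<open>a(n - t\<^sub>m\<^sub>-\<^sub>1)\<close>. Since \<open>z\<^sub>m\<^sub>-\<^sub>1\<close> also occurs right after the prefix of length \<open>t\<^sub>m\<^sub>-\<^sub>1\<close>, the difference counts the
  squares ending at \<open>n\<close> that begin within that prefix, and these can only come from
  \<open>(k, y) = (m - 1, 0)\<close>, \<open>(m - 2, 1)\<close> or \<open>(m - 3, 3)\<close>.
\<close>

section \<open>Cutting the Tribonacci word into the blocks \<open>sigma_letter x\<close>\<close>

definition letter_at :: "nat \<Rightarrow> letter" where
  "letter_at n = tribonacci !! n"

text \<open>Positions are counted from 0 here, so \<open>blk n\<close> is where the image of the letter at \<open>n\<close> begins.\<close>

definition blk :: "nat \<Rightarrow> nat" where
  "blk n = length (sigma (stake n tribonacci))"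

text \<open>The letter right after the \<open>La\<close> that opens the block of \<open>x\<close>.
  For \<open>Lc\<close>, whose block is \<open>La\<close> alone, it is the \<open>La\<close> opening
  the next block. In each case it is also the last letter of the block.\<close>

fun next_letter :: "letter \<Rightarrow> letter" where
  "next_letter La = Lb"
| "next_letter Lb = Lc"
| "next_letter Lc = La"

lemma next_letter_inj: "next_letter x = next_letter y \<longleftrightarrow> x = y"
  by (cases x; cases y) auto

lemma tribonacci_fixed: "shd tribonacci = La" "sigma_stream tribonacci = tribonacci"
  using theI'[OF ex1_tribonacci] by (simp_all add: tribonacci_def)

lemma sigma_stream_SCons: "sigma_stream (x ## s) = sigma_letter x @- sigma_stream s"
  using sigma_stream_shift[of "[x]" s] by (simp add: sigma_def)

lemma sdrop_blk: "sdrop (blk n) tribonacci = sigma_stream (sdrop n tribonacci)"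
proof -
  have "tribonacci = sigma (stake n tribonacci) @- sigma_stream (sdrop n tribonacci)"
    by (metis sigma_stream_shift stake_sdrop tribonacci_fixed(2))
  then show ?thesis by (metis blk_def sdrop_shift drop_all sdrop.simps(1) shift.simps(1)
        diff_self_eq_0 order_refl)
qed

lemma blk_0 [simp]: "blk 0 = 0"
  by (simp add: blk_def sigma_def)

lemma blk_Suc: "blk (Suc n) = blk n + (if letter_at n = Lc then 1 else 2)"
proof -
  have "stake (Suc n) tribonacci = stake n tribonacci @ [letter_at n]"
    unfolding letter_at_def by (rule stake_Suc)
  then show ?thesis
    by (cases "letter_at n") (simp_all add: blk_def sigma_append sigma_def del: stake.simps)
qed

lemma letter_at_0 [simp]: "letter_at 0 = La"
  using tribonacci_fixed(1) by (simp add: letter_at_def)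

lemma shd_sigma_stream: "shd (sigma_stream s) = La"
proof (cases s)
  case (SCons x r)
  then show ?thesis by (cases x) (simp_all add: sigma_stream_SCons)
qed

lemma letter_at_blk [simp]: "letter_at (blk n) = La"
proof -
  have "letter_at (blk n) = shd (sdrop (blk n) tribonacci)" by (simp add: letter_at_def)
  then show ?thesis by (simp only: sdrop_blk shd_sigma_stream)
qed

lemma sdrop_Suc_SCons: "sdrop n tribonacci = letter_at n ## sdrop (Suc n) tribonacci"
  by (rule stream.expand) (simp add: letter_at_def flip: sdrop_stl)

lemma letter_at_Suc_blk: "letter_at (Suc (blk n)) = next_letter (letter_at n)"
proof -
  have "letter_at (Suc (blk n)) = sdrop (blk n) tribonacci !! 1"
    by (simp add: letter_at_def sdrop_snth)
  also have "\<dots> = (sigma_letter (letter_at n) @- sigma_stream (sdrop (Suc n) tribonacci)) !! 1"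
    using sdrop_Suc_SCons[of n] by (simp only: sdrop_blk sigma_stream_SCons)
  also have "\<dots> = next_letter (letter_at n)"
    by (cases "letter_at n") (simp_all add: shd_sigma_stream)
  finally show ?thesis .
qed

lemma strict_mono_blk: "strict_mono blk"
  by (rule strict_mono_Suc_iff[THEN iffD2]) (simp add: blk_Suc)

lemma blk_cover: "\<exists>n. i = blk n \<or> i = Suc (blk n) \<and> letter_at n \<noteq> Lc"
proof (induction i)
  case 0
  then show ?case by (metis blk_0)
next
  case (Suc i)
  then obtain n where n: "i = blk n \<or> i = Suc (blk n) \<and> letter_at n \<noteq> Lc" by blast
  then have "Suc i = blk (Suc n) \<or> Suc i = Suc (blk n) \<and> letter_at n \<noteq> Lc"
    by (auto simp: blk_Suc)
  then show ?case by blast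
qed

text \<open>The second letter of a block is never \<open>La\<close>, so the block starts can be read
  off from the letters alone.\<close>

lemma La_position: "letter_at i = La \<Longrightarrow> \<exists>n. i = blk n"
  using blk_cover[of i] by (auto simp: letter_at_Suc_blk) (metis letter.distinct next_letter.elims)

lemma La_before: "letter_at (Suc i) \<noteq> La \<Longrightarrow> letter_at i = La"
  using blk_cover[of "Suc i"] by auto

text \<open>The last letter of a block depends only on the letter it comes from. So a mismatch just
  before two block starts comes from a mismatch one level down; this transports left
  maximality.\<close>

lemma last_of_block: "letter_at (blk (Suc n) - 1) = next_letter (letter_at n)"
  by (cases "letter_at n = Lc") (simp_all add: blk_Suc letter_at_Suc_blk)

text \<open>\<open>Lc\<close> is always followed by \<open>La\<close>, so two adjacent blocks never
  both have length 1.\<close>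

lemma blk_Suc_Suc: "blk n + 3 \<le> blk (Suc (Suc n))"
proof (cases "letter_at n = Lc")
  case True
  then have "letter_at (Suc n) = La" using La_before[of n] by force
  then show ?thesis by (simp add: blk_Suc)
qed (simp add: blk_Suc)

section \<open>Images of equal factors and the words \<open>z\<^sub>k\<close>\<close>

lemma blk_add_ge: "blk x + q \<le> blk (x + q)"
  by (induction q) (simp_all add: blk_Suc)

lemma blk_match_length:
  assumes "\<forall>j<q. letter_at (x + j) = letter_at (y + j)"
  shows "blk (x + q) + blk y = blk (y + q) + blk x"
  using assms by (induction q) (simp_all add: blk_Suc)

text \<open>Equal factors have equal images. Since every block begins with \<open>La\<close>, even
  the letter after the two images agrees; hence the bound on \<open>j\<close> is not strict.\<close>

lemma blk_match:
  assumes "\<forall>j<q. letter_at (x + j) = letter_at (y + j)" "blk x + j \<le> blk (x + q)"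
  shows "letter_at (blk x + j) = letter_at (blk y + j)"
  using assms
proof (induction q arbitrary: j)
  case 0
  then show ?case by simp
next
  case (Suc q)
  have len: "blk (x + q) + blk y = blk (y + q) + blk x"
    "blk (x + Suc q) + blk y = blk (y + Suc q) + blk x"
    using blk_match_length[of q x y] blk_match_length[of "Suc q" x y] Suc.prems(1) by auto
  consider "blk x + j \<le> blk (x + q)" | "blk x + j = Suc (blk (x + q))" | "blk x + j = blk (x + Suc q)"
    using Suc.prems(2) by (fastforce simp: blk_Suc split: if_splits)
  then show ?case
  proof cases
    case 1
    then show ?thesis using Suc by auto
  next
    case 2
    then have "blk y + j = Suc (blk (y + q))" using len by simp
    then show ?thesis using 2 Suc.prems(1) by (simp add: letter_at_Suc_blk)
  next
    case 3
    then have "blk y + j = blk (y + Suc q)" using len by simp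
    then show ?thesis using 3 by (metis letter_at_blk)
  qed
qed

text \<open>The length of the word \<open>z\<^sub>k\<close>.\<close>

fun window :: "nat \<Rightarrow> nat" where
  "window 0 = 0"
| "window (Suc k) = Suc (blk (window k))"

text \<open>Starting from the empty word, each level maps the common prefix through
  \<open>sigma\<close> and gains one \<open>La\<close> behind it. So \<open>z\<^sub>k\<close> stands
  at every \<open>(blk ^^ k) y\<close>, whatever letter is at \<open>y\<close>.\<close>

lemma letter_at_window: "j < window k \<Longrightarrow> letter_at ((blk ^^ k) y + j) = letter_at j"
proof (induction k arbitrary: j)
  case (Suc k)
  have m: "\<forall>j<window k. letter_at ((blk ^^ k) y + j) = letter_at (0 + j)"
    using Suc.IH by simp
  have "blk ((blk ^^ k) y) + j \<le> blk ((blk ^^ k) y + window k)"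
    using blk_match_length[OF m] Suc.prems by simp
  from blk_match[OF m this] show ?case by simp
qed simp

lemma blk_funpow_add:
  assumes "\<forall>j<q. letter_at (x + j) = letter_at j"
  shows "(blk ^^ k) (x + q) = (blk ^^ k) x + (blk ^^ k) q"
  using assms
proof (induction k arbitrary: x q)
  case (Suc k)
  have m: "\<forall>j<q. letter_at (x + j) = letter_at (0 + j)" using Suc.prems by simp
  have len: "blk (x + q) = blk x + blk q" using blk_match_length[OF m] by simp
  have "\<forall>j<blk q. letter_at (blk x + j) = letter_at j"
    using blk_match[OF m] len by simp
  from Suc.IH[OF this] show ?case by (simp add: funpow_swap1 len)
qed simp

section \<open>Repetitions traced back through \<open>sigma\<close>\<close>

lemma strict_mono_blk_funpow: "strict_mono (blk ^^ k)"
proof (induction k)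
  case (Suc k)
  then show ?case using strict_mono_blk by (simp add: strict_mono_def)
qed (simp add: strict_mono_def)

text \<open>The bound \<open>L \<le> Suc q\<close>, instead of \<open>L \<le> q\<close> as for squares, is the one inherited by the preimage:
  an unmatched tail of two letters has an image of length at least 3, of which only one letter
  gets matched.\<close>

lemma left_maximal_repetition:
  assumes "0 < L" "L \<le> Suc q" "\<forall>j<q. letter_at (x + j) = letter_at (x + L + j)"
    "x = 0 \<or> letter_at (x - 1) \<noteq> letter_at (x + L - 1)"
  shows "\<exists>k y. x = (blk ^^ k) y \<and> x + L = (blk ^^ k) (Suc y) \<and> q \<le> window k"
  using assms
proof (induction q arbitrary: x L rule: less_induct)
  case (less q)
  show ?case
  proof (cases "q = 0")
    case True
    \<comment> \<open>The base case is a single letter with empty matching word, that is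
      \<open>k = 0\<close> and \<open>y = x\<close>.\<close>
    then have "L = 1" using less.prems by simp
    then show ?thesis using True by (intro exI[of _ 0] exI[of _ x]) simp
  next
    case False
    have eq: "letter_at (x + L) = letter_at x" using less.prems(3) False by (metis add_0_right neq0_conv)
    \<comment> \<open>A letter other than \<open>La\<close> at both starts would be preceded by
      \<open>La\<close> in both places, against left maximality.\<close>
    have La: "letter_at x = La"
    proof (rule ccontr)
      assume n: "letter_at x \<noteq> La"
      then obtain z where z: "x = Suc z" by (cases x) auto
      have "letter_at z = La" using n La_before z by blast
      moreover have "letter_at (z + L) = La" using n La_before[of "z + L"] eq z by simp
      ultimately show False using less.prems(4) z by simp
    qed
    obtain x' where x': "x = blk x'" using La_position La by blast
    obtain y' where y': "x + L = blk y'" using La_position La eq by metis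
    have "x' < y'" using x' y' less.prems(1) strict_mono_less[OF strict_mono_blk] by (metis less_add_same_cancel1)
    then obtain L' where L': "y' = x' + L'" "0 < L'" using less_imp_add_positive by metis
    have left: "x' = 0 \<or> letter_at (x' - 1) \<noteq> letter_at (x' + L' - 1)"
    proof (cases x')
      case (Suc z)
      have "letter_at (x - 1) = next_letter (letter_at z)"
        "letter_at (x + L - 1) = next_letter (letter_at (z + L'))"
        using last_of_block[of z] last_of_block[of "z + L'"] Suc x' y' L' by simp_all
      moreover have "x \<noteq> 0" using Suc x' blk_add_ge[of 0 x'] by simp
      ultimately show ?thesis using less.prems(4) Suc by auto
    qed simp
    \<comment> \<open>\<open>q'\<close> is the length of the match one level down, cut off at
      \<open>q - 1\<close> so that the induction hypothesis applies.\<close>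
    obtain q' where q': "q' < q" "\<forall>j<q'. letter_at (x' + j) = letter_at (x' + L' + j)"
      "q' = q - 1 \<or> letter_at (x' + q') \<noteq> letter_at (x' + L' + q')"
    proof (cases "\<forall>j<q - 1. letter_at (x' + j) = letter_at (x' + L' + j)")
      case True
      then show ?thesis using that[of "q - 1"] False by simp
    next
      case ex: False
      define P where "P j \<longleftrightarrow> letter_at (x' + j) \<noteq> letter_at (x' + L' + j)" for j
      obtain j0 where j0: "j0 < q - 1" "P j0" using ex P_def by blast
      define j1 where "j1 = (LEAST j. P j)"
      have "j1 < q" using Least_le[of P, OF j0(2)] j0(1) by (simp add: j1_def)
      moreover have "P j1" unfolding j1_def by (rule LeastI[of P, OF j0(2)])
      moreover have "\<forall>j<j1. \<not> P j" unfolding j1_def using not_less_Least[of _ P] by blast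
      ultimately show ?thesis using that[of j1] by (simp add: P_def)
    qed
    have len: "blk (x' + q') + blk (x' + L') = blk (x' + L' + q') + blk x'"
      by (rule blk_match_length[OF q'(2)])
    \<comment> \<open>At the first mismatch the two blocks still share their \<open>La\<close>; the
      letters after it differ because \<open>next_letter\<close> is injective.\<close>
    have q_le: "x + q \<le> Suc (blk (x' + q'))"
    proof (cases "q' = q - 1")
      case True
      then show ?thesis using blk_add_ge[of x' q'] x' False by simp
    next
      case ne: False
      show ?thesis
      proof (rule ccontr)
        assume c: "\<not> ?thesis"
        define d where "d = Suc (blk (x' + q')) - x"
        have xd: "x + d = Suc (blk (x' + q'))" using blk_add_ge[of x' q'] x' by (simp add: d_def)
        then have "x + L + d = Suc (blk (x' + L' + q'))" using len x' y' L' by simp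
        moreover have "d < q" using c xd by simp
        ultimately have "letter_at (Suc (blk (x' + q'))) = letter_at (Suc (blk (x' + L' + q')))"
          using less.prems(3) xd by metis
        then show False using q'(3) ne by (simp add: letter_at_Suc_blk next_letter_inj)
      qed
    qed
    have "L' \<le> Suc q'"
    proof (rule ccontr)
      assume "\<not> ?thesis"
      then have "x' + q' + 2 \<le> x' + L'" by simp
      then have "blk (x' + q' + 2) \<le> blk (x' + L')"
        using strict_mono_less_eq[OF strict_mono_blk] by blast
      then have "blk (x' + q') + 3 \<le> x + L" using blk_Suc_Suc[of "x' + q'"] y' L' by simp
      then show False using q_le less.prems(2) by simp
    qed
    from less.IH[OF q'(1) L'(2) this q'(2) left] obtain k y where
      ky: "x' = (blk ^^ k) y" "x' + L' = (blk ^^ k) (Suc y)" "q' \<le> window k" by blast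
    \<comment> \<open>The \<open>q'\<close> letters at \<open>x'\<close> form a prefix of
      \<open>z\<^sub>k\<close>, so their image has length \<open>blk q'\<close>; the extra letter in
      \<open>q_le\<close> is the \<open>Suc\<close> of \<open>window (Suc k)\<close>.\<close>
    have "\<forall>j<q'. letter_at (x' + j) = letter_at (0 + j)"
      using letter_at_window ky by auto
    from blk_match_length[OF this] have "blk (x' + q') = blk q' + x" using x' by simp
    moreover have "blk q' \<le> blk (window k)"
      using ky(3) strict_mono_less_eq[OF strict_mono_blk] by blast
    ultimately have "q \<le> window (Suc k)" using q_le by simp
    then show ?thesis using ky x' y' L'
      by (intro exI[of _ "Suc k"] exI[of _ y]) simp
  qed
qed

text \<open>The repetition is extended to the left, keeping \<open>L\<close> while \<open>q\<close>
  grows, up to the start of the word or a mismatch; there \<open>left_maximal_repetition\<close>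
  applies.\<close>

lemma repetition_origin:
  assumes "0 < L" "L \<le> Suc q" "\<forall>j<q. letter_at (x + j) = letter_at (x + L + j)"
  shows "\<exists>k y. (blk ^^ k) y \<le> x \<and> (blk ^^ k) (Suc y) = (blk ^^ k) y + L
    \<and> x + q \<le> (blk ^^ k) y + window k"
  using assms
proof (induction x arbitrary: q)
  case 0
  then show ?case using left_maximal_repetition[of L q 0] by fastforce
next
  case (Suc x)
  show ?case
  proof (cases "letter_at x = letter_at (x + L)")
    case True
    have "\<forall>j<Suc q. letter_at (x + j) = letter_at (x + L + j)"
      using True Suc.prems(3) by (auto simp: less_Suc_eq_0_disj)
    then have "\<exists>k y. (blk ^^ k) y \<le> x \<and> (blk ^^ k) (Suc y) = (blk ^^ k) y + L
      \<and> x + Suc q \<le> (blk ^^ k) y + window k"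
      using Suc.IH[of "Suc q"] Suc.prems by simp
    then show ?thesis by (metis add_Suc_shift le_SucI)
  next
    case False
    then have "\<exists>k y. Suc x = (blk ^^ k) y \<and> Suc x + L = (blk ^^ k) (Suc y) \<and> q \<le> window k"
      using left_maximal_repetition[of L q "Suc x"] Suc.prems by simp
    then show ?thesis by (metis add_left_mono order_refl)
  qed
qed

section \<open>Squares described by their periods\<close>

text \<open>A square of period \<open>l\<close> whose last letter has position \<open>n\<close>,
  counted from 1, occupies the positions \<open>n - 2 * l\<close> to \<open>n - 1\<close>, counted
  from 0.\<close>

definition periods_at :: "nat \<Rightarrow> nat set" where
  "periods_at n = {l. 0 < l \<and> 2 * l \<le> n \<and>
     (\<forall>j<l. letter_at (n - 2 * l + j) = letter_at (n - l + j))}"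

lemma periods_at_add:
  "l \<in> periods_at (i + 2 * l) \<longleftrightarrow> 0 < l \<and> (\<forall>j<l. letter_at (i + j) = letter_at (i + l + j))"
proof -
  have "i + 2 * l - l = i + l" "i + 2 * l - 2 * l = i" by simp_all
  then show ?thesis unfolding periods_at_def by (simp only: mem_Collect_eq) simp
qed

lemma periods_atE:
  assumes "l \<in> periods_at n"
  obtains i where "n = i + 2 * l" "0 < l" "\<forall>j<l. letter_at (i + j) = letter_at (i + l + j)"
proof -
  have "n = (n - 2 * l) + 2 * l" using assms by (simp add: periods_at_def)
  then show ?thesis using that assms periods_at_add by metis
qed

text \<open>A square is a repetition with \<open>q = l\<close>, so \<open>repetition_origin\<close>
  places it inside a run of period \<open>l\<close> from \<open>(blk ^^ k) y\<close> up to
  \<open>(blk ^^ k) (Suc y) + window k\<close>. Conversely, any \<open>2 * l\<close> consecutive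
  letters of such a run form a square.\<close>

lemma periods_at_iff:
  "l \<in> periods_at n \<longleftrightarrow> (\<exists>k y. (blk ^^ k) (Suc y) = (blk ^^ k) y + l \<and>
     (blk ^^ k) y + 2 * l \<le> n \<and> n \<le> (blk ^^ k) (Suc y) + window k)"
proof
  assume "l \<in> periods_at n"
  then obtain i where n: "n = i + 2 * l" "0 < l"
    and rep: "\<forall>j<l. letter_at (i + j) = letter_at (i + l + j)" by (rule periods_atE)
  from repetition_origin[OF n(2) _ rep] obtain k y where ky: "(blk ^^ k) y \<le> i"
    "(blk ^^ k) (Suc y) = (blk ^^ k) y + l" "i + l \<le> (blk ^^ k) y + window k"
    by auto
  then show "\<exists>k y. (blk ^^ k) (Suc y) = (blk ^^ k) y + l \<and>
     (blk ^^ k) y + 2 * l \<le> n \<and> n \<le> (blk ^^ k) (Suc y) + window k"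
    using n by (intro exI[of _ k] exI[of _ y]) simp
next
  assume "\<exists>k y. (blk ^^ k) (Suc y) = (blk ^^ k) y + l \<and>
     (blk ^^ k) y + 2 * l \<le> n \<and> n \<le> (blk ^^ k) (Suc y) + window k"
  then obtain k y where ky: "(blk ^^ k) (Suc y) = (blk ^^ k) y + l"
     "(blk ^^ k) y + 2 * l \<le> n" "n \<le> (blk ^^ k) (Suc y) + window k" by blast
  have "(blk ^^ k) y < (blk ^^ k) (Suc y)" by (rule strict_monoD[OF strict_mono_blk_funpow]) simp
  then have l: "0 < l" using ky by simp
  have "letter_at (n - 2 * l + j) = letter_at (n - l + j)" if "j < l" for j
  proof -
    define d where "d = n - 2 * l - (blk ^^ k) y + j"
    have "d < window k" using ky that by (simp add: d_def)
    then have "letter_at ((blk ^^ k) y + d) = letter_at ((blk ^^ k) (Suc y) + d)"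
      using letter_at_window by simp
    moreover have "(blk ^^ k) y + d = n - 2 * l + j" "(blk ^^ k) (Suc y) + d = n - l + j"
      using ky by (simp_all add: d_def)
    ultimately show ?thesis by simp
  qed
  then show "l \<in> periods_at n" using ky l by (simp add: periods_at_def)
qed

lemma periods_atI:
  assumes "(blk ^^ k) y = a" "(blk ^^ k) (Suc y) = a + l" "a + 2 * l \<le> n" "n \<le> a + l + window k"
  shows "l \<in> periods_at n"
  unfolding periods_at_iff using assms by (intro exI[of _ k] exI[of _ y]) simp

section \<open>Tribonacci numbers, the lengths of \<open>z\<^sub>k\<close> and the kernel
  numbers\<close>

lemma stake_trib: "stake (trib k) tribonacci = (sigma ^^ k) [La]"
proof (induction k)
  case 0
  then show ?case using tribonacci_fixed(1) by (simp add: trib_init)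
next
  case (Suc k)
  then show ?case using stake_sigma_stream[of "trib k" tribonacci] tribonacci_fixed(2)
    by (simp add: trib_def)
qed

lemma blk_trib: "blk (trib k) = trib (Suc k)"
  unfolding blk_def stake_trib by (simp add: trib_def)

lemma blk_funpow_trib: "(blk ^^ k) (trib i) = trib (k + i)"
  by (induction k) (simp_all add: blk_trib)

lemma blk_funpow_0 [simp]: "(blk ^^ k) 0 = 0"
  by (induction k) simp_all

lemma blk_funpow_1: "(blk ^^ k) (Suc 0) = trib k"
  using blk_funpow_trib[of k 0] by (simp add: trib_init)

lemma blk_funpow_2: "(blk ^^ k) 2 = trib (Suc k)"
  using blk_funpow_trib[of k 1] by (simp add: trib_init)

lemma blk_funpow_4: "(blk ^^ k) 4 = trib (Suc (Suc k))"
  using blk_funpow_trib[of k 2] trib_init by (simp add: numeral_2_eq_2)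

lemma blk_funpow_3: "(blk ^^ k) 3 = trib (Suc k) + trib k"
proof -
  \<comment> \<open>Index 2 is a block start, so the images of the letter there are as long as those
    of the first letter.\<close>
  have "letter_at 2 = La"
    by (metis letter_at_blk blk_trib trib_init(1,2))
  then have "(blk ^^ k) (2 + 1) = (blk ^^ k) 2 + (blk ^^ k) 1"
    by (intro blk_funpow_add) simp
  then show ?thesis by (simp add: blk_funpow_1 blk_funpow_2)
qed

text \<open>\<open>z\<^sub>k\<close> recurs right after the prefix of length \<open>trib k\<close>,
  so \<open>blk\<close> is additive at \<open>trib k + window k\<close>; this carries the
  induction.\<close>

lemma window_Suc: "window (Suc k) = window k + trib k"
proof (induction k)
  case 0
  then show ?case by (simp add: trib_init)
next
  case (Suc k)
  have "\<forall>j<window k. letter_at (trib k + j) = letter_at (0 + j)"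
    using letter_at_window[of _ k "Suc 0"] by (simp add: blk_funpow_1)
  from blk_match_length[OF this] have "blk (trib k + window k) = trib (Suc k) + blk (window k)"
    by (simp add: blk_trib)
  then show ?case using Suc by (simp add: add.commute)
qed

declare window.simps(2) [simp del]

text \<open>Translates the halved combinations of Tribonacci numbers that bound
  \<open>Gamma1\<close>, \<open>Gamma2\<close> and \<open>Gamma3\<close> into lengths of the words
  \<open>z\<^sub>k\<close>.\<close>

lemma window_eq_trib: "2 * window (Suc j) + 3 = trib (Suc (Suc j)) + trib j"
proof (induction j)
  case 0
  then show ?case by (simp add: trib_init window_Suc)
next
  case (Suc j)
  then show ?case by (simp add: trib_rec window_Suc[of "Suc j"])
qed

lemma trib_growth: "trib j < trib (Suc j)" "trib (Suc j) \<le> 2 * trib j"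
proof -
  have "trib j < trib (Suc j) \<and> trib (Suc j) \<le> 2 * trib j"
    by (induction j rule: kernel_num.induct) (simp_all add: trib_init trib_rec)
  then show "trib j < trib (Suc j)" "trib (Suc j) \<le> 2 * trib j" by auto
qed

lemma trib_mono: "i \<le> k \<Longrightarrow> trib i \<le> trib k"
  by (rule lift_Suc_mono_le[of trib]) (simp_all add: trib_growth less_imp_le)

lemma window_mono: "i \<le> k \<Longrightarrow> window i \<le> window k"
  by (rule lift_Suc_mono_le[of window]) (simp_all add: window_Suc)

lemma window_less_trib: "window j < 2 * trib j" "window j < trib (Suc j)" "trib j \<le> Suc (window j)"
proof -
  show "window j < 2 * trib j"
  proof (cases j)
    case (Suc i)
    then show ?thesis using window_eq_trib[of i] trib_growth[of i] trib_growth[of "Suc i"] by simp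
  qed (simp add: trib_init)
  show "window j < trib (Suc j)"
  proof (induction j)
    case (Suc j)
    then show ?case using trib_growth(1)[of j] trib_rec[of j] window_Suc[of j]
      by (cases j) (simp_all add: trib_init trib_rec)
  qed (simp add: trib_init)
  show "trib j \<le> Suc (window j)"
  proof (induction j rule: kernel_num.induct)
    case (4 j)
    then show ?case by (simp add: trib_rec window_Suc)
  qed (simp_all add: trib_init window_Suc)
qed

text \<open>Turns the numbers of zeros and ones in the recurrences into differences of
  \<open>window\<close> and \<open>trib\<close> values.\<close>

lemma kernel_num_window: "kernel_num (Suc j) = int (window (Suc j)) - 2 * int (trib j) + 2"
proof (induction j rule: kernel_num.induct)
  case (4 j)
  then show ?case using window_eq_trib[of j] by (simp add: window_Suc trib_rec)
qed (simp_all add: window_Suc trib_init numeral_3_eq_3)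

section \<open>Absence of fourth powers; squares as consecutive occurrences\<close>

text \<open>For \<open>k > 0\<close> the gap is the length of an iterated image of a block, which
  begins with \<open>La\<close>. So it is at least \<open>trib (k - 1)\<close>, while
  \<open>z\<^sub>k\<close> is shorter than three times that.\<close>

lemma window_less_gap: "window k < 3 * ((blk ^^ k) (Suc y) - (blk ^^ k) y)"
proof (cases k)
  case (Suc i)
  have "(blk ^^ i) (Suc (blk y)) \<le> (blk ^^ i) (blk (Suc y))"
    using strict_mono_less_eq[OF strict_mono_blk_funpow] by (simp add: blk_Suc)
  moreover have "(blk ^^ i) (blk y + 1) = (blk ^^ i) (blk y) + (blk ^^ i) 1"
    by (rule blk_funpow_add) simp
  ultimately have "(blk ^^ k) y + trib i \<le> (blk ^^ k) (Suc y)"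
    by (simp add: Suc funpow_swap1 blk_funpow_1)
  moreover have "window k < 3 * trib i"
    using window_less_trib(1)[of i] by (simp add: Suc window_Suc)
  ultimately show ?thesis by simp
qed simp

text \<open>The factor has \<open>q + L\<close> letters and period \<open>L\<close>, so the bound
  excludes fourth powers.\<close>

lemma repetition_length_less:
  assumes "0 < L" "L \<le> Suc q" "\<forall>j<q. letter_at (x + j) = letter_at (x + L + j)"
  shows "q < 3 * L"
proof -
  obtain k y where "(blk ^^ k) y \<le> x" "(blk ^^ k) (Suc y) = (blk ^^ k) y + L"
    "x + q \<le> (blk ^^ k) y + window k"
    using repetition_origin[OF assms] by blast
  then show ?thesis using window_less_gap[of k y] by simp
qed

text \<open>Ensures that the two halves of a square are consecutive occurrences, with none starting
  in between.\<close>

lemma no_occurrence_inside_square: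
  assumes square: "\<forall>j<l. letter_at (i + j) = letter_at (i + l + j)" and d: "0 < d" "d < l"
  shows "\<not> (\<forall>j<l. letter_at (i + d + j) = letter_at (i + j))"
proof
  assume inside: "\<forall>j<l. letter_at (i + d + j) = letter_at (i + j)"
  define g where "g j = letter_at (i + j)" for j
  have gl: "g (l + j) = g j" if "j < l" for j
    using square that by (simp add: g_def add.assoc)
  have gd: "g (d + j) = g j" if "j < l" for j
    using inside that by (simp add: g_def add.assoc)
  \<comment> \<open>The square then has both periods \<open>d\<close> and \<open>l - d\<close>, one of which is at most \<open>l / 2\<close>.\<close>
  have "g (d + j) = g j" if "j < 2 * l - d" for j
  proof (cases "j < l")
    case False
    then obtain j' where j': "j = l + j'" by (metis le_Suc_ex not_less)
    then have "d + j' < l" "j' < l" using that by auto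
    have "g (d + j) = g (l + (d + j'))" using j' by (simp add: ac_simps)
    also have "\<dots> = g (l + j')"
      using gl[OF \<open>d + j' < l\<close>] gd[OF \<open>j' < l\<close>] gl[OF \<open>j' < l\<close>] by simp
    finally show ?thesis using j' by simp
  qed (rule gd)
  then have "2 * l - d < 3 * d"
    using repetition_length_less[of d "2 * l - d" i] d by (simp add: g_def add.assoc)
  moreover have "g (l - d + j) = g j" if "j < l + d" for j
  proof (cases "j < d")
    case True
    then have "l - d + j < l" "j < l" using d by auto
    have "g (l - d + j) = g (d + (l - d + j))" using gd[OF \<open>l - d + j < l\<close>] by (rule sym)
    also have "d + (l - d + j) = l + j" using d by simp
    also have "g (l + j) = g j" by (rule gl[OF \<open>j < l\<close>])
    finally show ?thesis .
  next
    case False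
    then obtain j' where j': "j = d + j'" by (metis le_Suc_ex not_less)
    then have "j' < l" using that by simp
    have "g (l - d + j) = g (l + j')" using j' d by simp
    also have "\<dots> = g (d + j')" using gl[OF \<open>j' < l\<close>] gd[OF \<open>j' < l\<close>] by simp
    finally show ?thesis using j' by simp
  qed
  then have "l + d < 3 * (l - d)"
    using repetition_length_less[of "l - d" "l + d" i] d by (simp add: g_def add.assoc)
  \<comment> \<open>The two bounds read \<open>l < 2 * d\<close> and
    \<open>2 * d < l\<close>.\<close>
  ultimately show False using d by simp
qed

lemma occurrences_iff:
  "i \<in> occurrences w \<longleftrightarrow> 1 \<le> i \<and> (\<forall>j<length w. letter_at (i - 1 + j) = w ! j)"
  by (simp add: occurrences_def list_eq_iff_nth_eq sdrop_snth letter_at_def)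

text \<open>Given \<open>n\<close>, the period determines the word and its start, hence also the
  index \<open>p\<close>; so the counted pairs correspond to the periods.\<close>

lemma num_squares_ending_at_eq: "num_squares_ending_at n = card (periods_at n)"
proof -
  define f where "f l = (let w = stake l (sdrop (n - 2 * l) tribonacci)
    in (w, card {j \<in> occurrences w. j \<le> Suc (n - 2 * l)}))" for l
  have "inj_on f (periods_at n)"
    by (rule inj_on_inverseI[where g = "length \<circ> fst"]) (simp add: f_def Let_def)
  moreover have "f ` periods_at n = {(w, p). w \<noteq> [] \<and> is_square_ending_at w p n}"
  proof (intro equalityI subsetI)
    fix z assume "z \<in> f ` periods_at n"
    then obtain l where l: "l \<in> periods_at n" and z: "z = f l" by blast
    from l obtain i where l': "0 < l" "n = i + 2 * l"
      "\<forall>j<l. letter_at (i + j) = letter_at (i + l + j)" by (rule periods_atE)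
    define w where "w = stake l (sdrop i tribonacci)"
    define p where "p = card {j \<in> occurrences w. j \<le> Suc i}"
    have w: "w ! j = letter_at (i + j)" if "j < l" for j
      using that by (simp add: w_def letter_at_def sdrop_snth)
    have len: "length w = l" by (simp add: w_def)
    have occ: "Suc i \<in> occurrences w" "Suc i + l \<in> occurrences w"
      using l'(3) by (simp_all add: occurrences_iff len w)
    \<comment> \<open>With no occurrence strictly between \<open>Suc i\<close> and
      \<open>Suc i + l\<close>, the index goes up by exactly one.\<close>
    have "j \<le> Suc i" if j: "j \<in> occurrences w" "j < Suc i + l" for j
    proof (rule ccontr)
      assume n: "\<not> ?thesis"
      define d where "d = j - Suc i"
      have d: "0 < d" "d < l" "j - 1 = i + d" using n j by (simp_all add: d_def)
      have "\<forall>j<l. letter_at (i + d + j) = letter_at (i + j)"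
        using j(1) d(3) by (simp add: occurrences_iff len w)
      then show False using no_occurrence_inside_square[OF l'(3) d(1,2)] by blast
    qed
    then have "{j \<in> occurrences w. j \<le> Suc i + l} =
        insert (Suc i + l) {j \<in> occurrences w. j \<le> Suc i}"
      using occ by (auto simp: le_less)
    then have "card {j \<in> occurrences w. j \<le> Suc i + l} = p + 1"
      using l'(1) by (simp add: p_def)
    then have "is_square_ending_at w p n"
      unfolding is_square_ending_at_def is_pth_occurrence_def
      using occ l'(2) by (intro exI[of _ "Suc i"]) (simp add: p_def len)
    moreover have "z = (w, p)" by (simp add: z f_def Let_def w_def p_def l'(2))
    moreover have "w \<noteq> []" using len l'(1) by auto
    ultimately show "z \<in> {(w, p). w \<noteq> [] \<and> is_square_ending_at w p n}" by simp
  next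
    fix z assume "z \<in> {(w, p). w \<noteq> [] \<and> is_square_ending_at w p n}"
    then obtain w p i where z: "z = (w, p)" "w \<noteq> []" and
      i: "is_pth_occurrence w p i" "is_pth_occurrence w (p + 1) (i + length w)"
      "n = i + 2 * length w - 1"
      unfolding is_square_ending_at_def by auto
    have "1 \<le> i" using i(1) by (simp add: is_pth_occurrence_def occurrences_iff)
    then obtain i' where i': "i = Suc i'" by (cases i) auto
    have n: "n = i' + 2 * length w" "n - 2 * length w = i'" using i(3) i' by simp_all
    have occ: "Suc i' \<in> occurrences w" "Suc (i' + length w) \<in> occurrences w"
      "card {j \<in> occurrences w. j \<le> Suc i'} = p"
      using i i' by (simp_all add: is_pth_occurrence_def)
    have "length w \<in> periods_at n"
      unfolding n(1) periods_at_add using z(2) occ(1,2) by (simp add: occurrences_iff)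
    moreover have "stake (length w) (sdrop i' tribonacci) = w"
      using occ(1) by (simp add: occurrences_def)
    then have "z = f (length w)"
      unfolding f_def Let_def n(2) z(1) using occ(3) by simp
    ultimately show "z \<in> f ` periods_at n" by blast
  qed
  ultimately show ?thesis unfolding num_squares_ending_at_def by (metis card_image)
qed

section \<open>Comparing the squares ending at \<open>trib (j + 3) + i\<close> with those ending at
  \<open>i\<close>\<close>

lemma finite_periods_at: "finite (periods_at n)"
  by (rule finite_subset[of _ "{..n}"]) (auto simp: periods_at_def)

text \<open>By \<open>2 * l <= i\<close> the square begins behind the prefix of length
  \<open>trib k\<close>, hence lies in the copy of \<open>z\<^sub>k\<close> standing there.\<close>

lemma periods_at_shift:
  assumes "i \<le> window k" "2 * l \<le> i"
  shows "l \<in> periods_at (trib k + i) \<longleftrightarrow> l \<in> periods_at i"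
proof -
  obtain b where b: "i = b + 2 * l" using assms(2) by (metis le_Suc_ex add.commute)
  have "letter_at (trib k + a) = letter_at a" if "a < i" for a
    using letter_at_window[of a k "Suc 0"] that assms(1) by (simp add: blk_funpow_1)
  then have "letter_at (trib k + b + a) = letter_at (b + a)" if "a < 2 * l" for a
    using that b by (simp add: add.assoc)
  from this this[of "l + _"] have
    "letter_at (trib k + b + a) = letter_at (b + a) \<and>
     letter_at (trib k + b + l + a) = letter_at (b + l + a)" if "a < l" for a
    using that by (simp add: add.assoc)
  then show ?thesis
    using periods_at_add[of l "trib k + b"] periods_at_add[of l b] by (simp add: b add.assoc)
qed

text \<open>All indices are \<open>j\<close> plus a constant, so that later comparisons reduce to
  linear arithmetic. In the recurrences \<open>j\<close> is \<open>m - 4\<close>.\<close>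

lemma trib_window_facts:
  "trib (j + 3) = trib (j + 2) + trib (j + 1) + trib j"
  "window (j + 1) = window j + trib j"
  "window (j + 2) = window (j + 1) + trib (j + 1)"
  "window (j + 3) = window (j + 2) + trib (j + 2)"
  "window (j + 4) = trib (j + 3) + window (j + 3)"
  "2 * trib j \<le> Suc (window (j + 1))" "window (j + 1) < trib (j + 1) + trib j"
  "window (j + 2) < trib (j + 3)" "trib (j + 3) \<le> Suc (window (j + 3))" "trib j < trib (j + 1)"
  "kernel_num (j + 4) = int (window (j + 4)) - 2 * int (trib (j + 3)) + 2"
  "kernel_num (j + 1) = int (window (j + 1)) - 2 * int (trib j) + 2"
proof -
  have idx: "j + 1 = Suc j" "j + 2 = Suc (Suc j)" "j + 3 = Suc (Suc (Suc j))"
    "j + 4 = Suc (Suc (Suc (Suc j)))" by simp_all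
  note rec = trib_rec[of j] window_Suc[of j] window_Suc[of "Suc j"] window_Suc[of "Suc (Suc j)"]
    window_Suc[of "Suc (Suc (Suc j))"]
  show "trib (j + 3) = trib (j + 2) + trib (j + 1) + trib j"
    "window (j + 1) = window j + trib j"
    "window (j + 2) = window (j + 1) + trib (j + 1)"
    "window (j + 3) = window (j + 2) + trib (j + 2)"
    "window (j + 4) = trib (j + 3) + window (j + 3)"
    unfolding idx using rec by linarith+
  show "2 * trib j \<le> Suc (window (j + 1))" "window (j + 1) < trib (j + 1) + trib j"
    "window (j + 2) < trib (j + 3)" "trib (j + 3) \<le> Suc (window (j + 3))" "trib j < trib (j + 1)"
    unfolding idx using rec window_less_trib(3)[of j] window_less_trib(2)[of j]
      window_less_trib(2)[of "Suc (Suc j)"] window_less_trib(3)[of "Suc (Suc (Suc j))"]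
      trib_growth(1)[of j] by linarith+
  show "kernel_num (j + 4) = int (window (j + 4)) - 2 * int (trib (j + 3)) + 2"
    "kernel_num (j + 1) = int (window (j + 1)) - 2 * int (trib j) + 2"
    unfolding idx by (rule kernel_num_window)+
qed

text \<open>By \<open>i < 2 * l\<close> the square begins within the prefix of length
  \<open>trib (j + 3)\<close>. Then \<open>j < k <= j + 3\<close> and
  \<open>y < trib (j + 3 - k)\<close>, which leaves seven pairs \<open>(k, y)\<close>. For four of
  them the run ends no later than \<open>trib (j + 3) + window j\<close>, against
  \<open>window j < i\<close>; the other three give the three cases.\<close>

lemma long_period_cases:
  assumes i: "window j < i" "i \<le> window (j + 3)"
    and l: "l \<in> periods_at (trib (j + 3) + i)" "i < 2 * l"
  shows "l = trib j
    \<or> l = trib (j + 1) + trib j \<and> l \<le> i \<and> i \<le> window (j + 2)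
    \<or> l = trib (j + 3) \<and> l \<le> i"
proof -
  define n where "n = trib (j + 3) + i"
  obtain k y where ky: "(blk ^^ k) (Suc y) = (blk ^^ k) y + l"
     "(blk ^^ k) y + 2 * l \<le> n" "n \<le> (blk ^^ k) (Suc y) + window k"
    using l(1) unfolding periods_at_iff n_def by blast
  note mono = strict_mono_less_eq[OF strict_mono_blk_funpow]
  have start: "(blk ^^ k) y < trib (j + 3)" using ky(2) l(2) by (simp add: n_def)
  have n: "n \<le> window (j + 4)" using i(2) trib_window_facts(5)[of j] by (simp add: n_def)
  \<comment> \<open>A larger \<open>k\<close> would force \<open>n\<close> beyond
    \<open>window (j + 4)\<close>: for \<open>y = 0\<close> because two periods must fit, otherwise
    because the second period word starts too late.\<close>
  have k: "k \<le> j + 3"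
  proof (rule ccontr)
    assume "\<not> k \<le> j + 3"
    then have "j + 4 \<le> k" by simp
    then have tr: "trib (j + 4) \<le> trib k" "trib (j + 5) \<le> trib (Suc k)"
      by (simp_all add: trib_mono)
    show False
    proof (cases y)
      case 0
      then have "l = trib k" using ky(1) by (simp add: blk_funpow_1)
      then show False using ky(2) n tr(1) window_less_trib(1)[of "j + 4"] by simp
    next
      case (Suc y')
      then have "(blk ^^ k) 2 \<le> (blk ^^ k) (Suc y)" by (simp add: mono)
      then have "trib (j + 5) \<le> n" using tr(2) ky by (simp add: blk_funpow_2)
      then show False using n window_less_trib(2)[of "j + 4"] by (simp add: eval_nat_numeral)
    qed
  qed
  define r where "r = j + 3 - k"
  have "trib (j + 3) = (blk ^^ k) (trib r)" using k by (simp add: blk_funpow_trib r_def)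
  then have y: "y < trib r" and "(blk ^^ k) (Suc y) \<le> trib (j + 3)"
    using start strict_mono_less[OF strict_mono_blk_funpow] by (simp_all add: mono Suc_leI)
  then have "window j < window k" using ky(3) i(1) by (simp add: n_def)
  have "j < k"
  proof (rule ccontr)
    assume "\<not> j < k"
    then have "window k \<le> window j" by (simp add: window_mono)
    with \<open>window j < window k\<close> show False by simp
  qed
  note t = trib_window_facts(1)[of j]
  note w = trib_window_facts(2-4)[of j]
  define g where "g = blk ^^ k"
  have g: "g 0 = 0" "g 1 = trib k" "g 2 = trib (k + 1)" "g (Suc (Suc 0)) = trib (k + 1)" "g 3 = trib (k + 1) + trib k"
    "g 4 = trib (k + 2)"
    using blk_funpow_2[of k]
    by (simp_all add: g_def blk_funpow_1 blk_funpow_3 blk_funpow_4 numeral_2_eq_2)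
  have gy: "g (y + 1) = g y + l" "g y + 2 * l \<le> n" "n \<le> g (y + 1) + window k"
    using ky by (simp_all add: g_def)
  consider "k = j + 3" | "k = j + 2" | "k = j + 1" using k \<open>j < k\<close> by linarith
  then show ?thesis
  proof cases
    case 1
    then have "y = 0" using y by (simp add: r_def trib_init)
    then have "l = trib (j + 3)" using gy(1) g 1 by simp
    then show ?thesis using gy(2) by (simp add: n_def)
  next
    case 2
    then have "trib (k + 1) = trib (j + 3)" by (simp add: eval_nat_numeral)
    note g' = g(1-4)[unfolded this, unfolded 2]
    have "y < 2" using y trib_init 2 by (simp add: r_def)
    then consider "y = 0" | "y = 1" by linarith
    then show ?thesis
    proof cases
      case 1
      then have "n \<le> trib (j + 2) + window (j + 2)" using gy(3) 2 g' by simp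
      then show ?thesis using i(1) t w by (simp add: n_def)
    next
      case y1: 2
      then have "g (y + 1) = trib (j + 3)" "g y = trib (j + 2)" using g' by simp_all
      then show ?thesis using gy 2 t by (simp add: n_def)
    qed
  next
    case 3
    then have "trib (k + 1) = trib (j + 2)" "trib (k + 2) = trib (j + 3)"
      by (simp_all add: eval_nat_numeral)
    note g' = g[unfolded this, unfolded 3]
    have "y < 4" using y trib_init 3 by (simp add: r_def numeral_2_eq_2)
    then consider "y = 0" | "y = 1" | "y = 2" | "y = 3" by linarith
    then show ?thesis
    proof cases
      case 1
      then have "n \<le> trib (j + 1) + window (j + 1)" using gy(3) 3 g' by simp
      then show ?thesis using i(1) t w by (simp add: n_def)
    next
      case 2
      then have "n \<le> trib (j + 2) + window (j + 1)" using gy(3) 3 g' by simp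
      then show ?thesis using i(1) t w by (simp add: n_def)
    next
      case y2: 3
      then have "n \<le> trib (j + 2) + trib (j + 1) + window (j + 1)" using gy(3) 3 g' by simp
      then show ?thesis using i(1) t w by (simp add: n_def)
    next
      case 4
      then have "g (y + 1) = trib (j + 3)" "g y = trib (j + 2) + trib (j + 1)" using g' by simp_all
      then show ?thesis using gy(1) t by simp
    qed
  qed
qed

text \<open>Squares are split by their start: those behind the prefix of length
  \<open>trib (j + 3)\<close> match the squares ending at \<open>i\<close>, the others form
  \<open>long\<close>. The three conditions exclude each other, so \<open>long\<close> has at most
  one element.\<close>

lemma num_squares_shift:
  assumes i: "window j < i" "i \<le> window (j + 3)"
  shows "num_squares_ending_at (trib (j + 3) + i) = num_squares_ending_at i +
    (if i < 2 * trib j \<or> trib (j + 1) + trib j \<le> i \<and> i \<le> window (j + 2) \<or> trib (j + 3) \<le> i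
     then 1 else 0)"
proof -
  define n where "n = trib (j + 3) + i"
  define long where "long = {l \<in> periods_at n. i < 2 * l}"
  note t = trib_window_facts(1)[of j]
  note w = trib_window_facts(2-4)[of j]
  note bounds = trib_window_facts(6-8,10)[of j]
  \<comment> \<open>The origins \<open>(k, y)\<close> behind \<open>mem1\<close>,
    \<open>mem2\<close> and \<open>mem3\<close> are \<open>(j + 1, 3)\<close>,
    \<open>(j + 2, 1)\<close> and \<open>(j + 3, 0)\<close>.\<close>
  have mem1: "trib j \<in> long" if "i < 2 * trib j"
  proof -
    have "trib j \<in> periods_at n"
    proof (rule periods_atI)
      show "(blk ^^ Suc j) 3 = trib (j + 2) + trib (j + 1)" by (simp only: blk_funpow_3) simp
      show "(blk ^^ Suc j) (Suc 3) = trib (j + 2) + trib (j + 1) + trib j"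
        using blk_funpow_4[of "Suc j"] by (simp add: trib_rec del: funpow.simps)
    qed (use that i t w bounds window_less_trib(3)[of j] in \<open>simp_all add: n_def\<close>)
    then show ?thesis using that by (simp add: long_def)
  qed
  have mem2: "trib (j + 1) + trib j \<in> long" if "trib (j + 1) + trib j \<le> i" "i \<le> window (j + 2)"
  proof -
    have "trib (j + 1) + trib j \<in> periods_at n"
    proof (rule periods_atI)
      show "(blk ^^ (j + 2)) 1 = trib (j + 2)" by (simp only: blk_funpow_1 One_nat_def)
      show "(blk ^^ (j + 2)) (Suc 1) = trib (j + 2) + (trib (j + 1) + trib j)"
        using blk_funpow_2[of "j + 2"] by (simp add: trib_rec numeral_2_eq_2 del: funpow.simps)
    qed (use that i t in \<open>simp_all add: n_def\<close>)
    moreover have "i < 2 * (trib (j + 1) + trib j)"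
      using that(2) w bounds by simp
    ultimately show ?thesis by (simp add: long_def)
  qed
  have mem3: "trib (j + 3) \<in> long" if "trib (j + 3) \<le> i"
  proof -
    have "trib (j + 3) \<in> periods_at n"
    proof (rule periods_atI)
      show "(blk ^^ (j + 3)) 0 = 0" by (rule blk_funpow_0)
      show "(blk ^^ (j + 3)) (Suc 0) = 0 + trib (j + 3)" by (simp only: blk_funpow_1 add_0)
    qed (use that i in \<open>simp_all add: n_def\<close>)
    moreover have "i < 2 * trib (j + 3)"
      using i(2) window_less_trib(1)[of "j + 3"] by simp
    ultimately show ?thesis by (simp add: long_def)
  qed
  have only: "l = trib j \<and> i < 2 * trib j
    \<or> l = trib (j + 1) + trib j \<and> l \<le> i \<and> i \<le> window (j + 2)
    \<or> l = trib (j + 3) \<and> l \<le> i" if "l \<in> long" for l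
    using long_period_cases[OF i, of l] that by (auto simp: long_def n_def)
  have disjoint: "\<not> trib (j + 3) \<le> i" "\<not> (trib (j + 1) + trib j \<le> i \<and> i \<le> window (j + 2))"
    if "i < 2 * trib j" using that bounds t by simp_all
  have disjoint': "\<not> trib (j + 3) \<le> i" if "i \<le> window (j + 2)" using that bounds(3) by simp
  consider (1) "i < 2 * trib j" | (2) "trib (j + 1) + trib j \<le> i" "i \<le> window (j + 2)"
    | (3) "trib (j + 3) \<le> i" | (none) "\<not> i < 2 * trib j" "\<not> trib (j + 3) \<le> i"
      "\<not> (trib (j + 1) + trib j \<le> i \<and> i \<le> window (j + 2))" by blast
  then have card: "card long = (if i < 2 * trib j \<or> trib (j + 1) + trib j \<le> i \<and> i \<le> window (j + 2)
      \<or> trib (j + 3) \<le> i then 1 else 0)"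
  proof cases
    case 1
    then have "long = {trib j}" using mem1 only disjoint by blast
    then show ?thesis using 1 by simp
  next
    case 2
    then have "long = {trib (j + 1) + trib j}" using mem2 only disjoint disjoint' by blast
    then show ?thesis using 2 by simp
  next
    case 3
    then have "long = {trib (j + 3)}" using mem3 only disjoint disjoint' by blast
    then show ?thesis using 3 by simp
  next
    case none
    then have "long = {}" using only by blast
    then show ?thesis using none by auto
  qed
  have union: "periods_at n = periods_at i \<union> long"
  proof -
    have "l \<in> periods_at n \<longleftrightarrow> l \<in> periods_at i \<or> l \<in> long" for l
    proof (cases "2 * l \<le> i")
      case True
      then show ?thesis using periods_at_shift[OF i(2) True] by (simp add: n_def long_def)
    next
      case False
      then show ?thesis by (simp add: long_def periods_at_def)
    qed
    then show ?thesis by blast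
  qed
  have "card (periods_at n) = card (periods_at i) + card long"
    unfolding union
  proof (rule card_Un_disjoint)
    show "finite (periods_at i)" by (rule finite_periods_at)
    show "finite long" unfolding long_def using finite_periods_at[of n] by simp
    show "periods_at i \<inter> long = {}" by (auto simp: long_def periods_at_def)
  qed
  then show ?thesis
    unfolding num_squares_ending_at_eq n_def[symmetric] by (simp only: card)
qed

section \<open>The three sets as intervals, and their vectors\<close>

lemma window_trib_index:
  assumes "3 \<le> m"
  shows "window m = trib (m - 1) + window (m - 1)" "window (m - 1) = trib (m - 2) + window (m - 2)"
    "window (m - 2) = trib (m - 3) + window (m - 3)" "trib m = trib (m - 1) + trib (m - 2) + trib (m - 3)"
    "2 * window (m - 1) + 3 = trib m + trib (m - 2)"
proof -
  define j where "j = m - 3"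
  have m: "m = Suc (Suc (Suc j))" "m - 1 = Suc (Suc j)" "m - 2 = Suc j" "m - 3 = j"
    using assms by (simp_all add: j_def)
  show "window m = trib (m - 1) + window (m - 1)" "window (m - 1) = trib (m - 2) + window (m - 2)"
    "window (m - 2) = trib (m - 3) + window (m - 3)" "trib m = trib (m - 1) + trib (m - 2) + trib (m - 3)"
    "2 * window (m - 1) + 3 = trib m + trib (m - 2)"
    using window_eq_trib[of "Suc j"] trib_rec[of j] window_Suc[of "Suc (Suc j)"]
      window_Suc[of "Suc j"] window_Suc[of j]
    unfolding m(2-4) unfolding m(1) by linarith+
qed

text \<open>Up to a shift by \<open>trib (m - 1)\<close>, the three sets lie between the consecutive
  values of \<open>window\<close> at \<open>m - 4\<close>, \<open>m - 3\<close>,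
  \<open>m - 2\<close> and \<open>m - 1\<close>; this fits them to
  \<open>num_squares_shift\<close>.\<close>

lemma Gamma_eq:
  assumes "4 \<le> m"
  shows "Gamma3 m = {Suc (window (m - 1))..trib (m - 1) + window (m - 3)}"
    "Gamma2 m = {Suc (trib (m - 1) + window (m - 3))..trib (m - 1) + window (m - 2)}"
    "Gamma1 m = {Suc (trib (m - 1) + window (m - 2))..window m}"
proof -
  have "3 \<le> m" using assms by simp
  note w = window_trib_index[OF this]
  have iw: "2 * int (window (m - 1)) + 3 = int (trib m) + int (trib (m - 2))"
    "int (window (m - 1)) = int (trib (m - 2)) + int (window (m - 2))"
    "int (window (m - 2)) = int (trib (m - 3)) + int (window (m - 3))"
    "int (window m) = int (trib (m - 1)) + int (window (m - 1))"
    "int (trib m) = int (trib (m - 1)) + int (trib (m - 2)) + int (trib (m - 3))"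
    using w by linarith+
  have "(int (trib m) + int (trib (m - 2)) - 1) div 2 = int (Suc (window (m - 1)))"
    "(- int (trib m) + 4 * int (trib (m - 1)) + int (trib (m - 2)) - 3) div 2
      = int (trib (m - 1) + window (m - 3))"
    "(- int (trib m) + 4 * int (trib (m - 1)) + int (trib (m - 2)) - 1) div 2
      = int (Suc (trib (m - 1) + window (m - 3)))"
    "(int (trib m) + 2 * int (trib (m - 1)) - int (trib (m - 2)) - 3) div 2
      = int (trib (m - 1) + window (m - 2))"
    "(int (trib m) + 2 * int (trib (m - 1)) - int (trib (m - 2)) - 1) div 2
      = int (Suc (trib (m - 1) + window (m - 2)))"
    "(int (trib m) + 2 * int (trib (m - 1)) + int (trib (m - 2)) - 3) div 2 = int (window m)"
    using iw by linarith+
  then show "Gamma3 m = {Suc (window (m - 1))..trib (m - 1) + window (m - 3)}"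
    "Gamma2 m = {Suc (trib (m - 1) + window (m - 3))..trib (m - 1) + window (m - 2)}"
    "Gamma1 m = {Suc (trib (m - 1) + window (m - 2))..window m}"
    unfolding Gamma1_def Gamma2_def Gamma3_def Let_def by (simp_all only: nat_int)
qed

lemma num_squares_vec_interval:
  "num_squares_vec {Suc a..b} = map num_squares_ending_at [Suc a..<Suc b]"
  unfolding num_squares_vec_def atLeastLessThanSuc_atLeastAtMost[symmetric]
  by (simp only: sorted_list_of_set_range)

lemma num_squares_vec_append:
  assumes "a \<le> b" "b \<le> c"
  shows "num_squares_vec {Suc a..b} @ num_squares_vec {Suc b..c} = num_squares_vec {Suc a..c}"
proof -
  have "[Suc a..<Suc c] = [Suc a..<Suc b] @ [Suc b..<Suc c]"
    using upt_add_eq_append[of "Suc a" "Suc b" "c - b"] assms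
    by (simp only: Suc_le_mono add_Suc le_add_diff_inverse)
  then show ?thesis by (simp only: num_squares_vec_interval map_append)
qed

lemma num_squares_vec_Gamma:
  assumes "4 \<le> m"
  shows "num_squares_vec (Gamma3 m) @ num_squares_vec (Gamma2 m) @ num_squares_vec (Gamma1 m)
    = num_squares_vec {Suc (window (m - 1))..window m}"
proof -
  have "3 \<le> m" using assms by simp
  note w = window_trib_index[OF this]
  have le: "window (m - 1) \<le> trib (m - 1) + window (m - 3)"
    "trib (m - 1) + window (m - 3) \<le> trib (m - 1) + window (m - 2)"
    "trib (m - 1) + window (m - 2) \<le> window m"
    using w window_less_trib(3)[of "m - 2"] window_less_trib(3)[of "m - 3"] by simp_all
  show ?thesis
    unfolding Gamma_eq[OF assms] num_squares_vec_append[OF le(2,3)]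
    by (rule num_squares_vec_append[OF le(1) le_trans[OF le(2,3)]])
qed

text \<open>Reduces a recurrence between vectors to comparing the counts at \<open>c + n\<close> and
  \<open>n\<close>, entry by entry.\<close>

lemma is_vec_sum_shift:
  assumes "a + length v = b"
    and "\<And>i. i < length v \<Longrightarrow>
      num_squares_ending_at (c + (Suc a + i)) = num_squares_ending_at (Suc a + i) + v ! i"
  shows "is_vec_sum (num_squares_vec {Suc (c + a)..c + b}) (num_squares_vec {Suc a..b}) v"
proof -
  have "num_squares_vec {Suc (c + a)..c + b} = map2 (+) (num_squares_vec {Suc a..b}) v"
    unfolding num_squares_vec_interval
    by (rule nth_equalityI) (use assms in \<open>auto simp: ac_simps simp del: upt_Suc\<close>)
  moreover have "length (num_squares_vec {Suc a..b}) = length v"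
    using assms(1) by (auto simp: num_squares_vec_interval simp del: upt_Suc)
  ultimately show ?thesis by (simp add: is_vec_sum_def)
qed

section \<open>The three recurrences\<close>

text \<open>Beyond \<open>window (j + 2)\<close> only a square of period \<open>trib (j + 3)\<close>
  can be new, and it appears from \<open>i = trib (j + 3)\<close> on; hence zeros, then
  ones.\<close>

lemma Gamma1_recurrence:
  "is_vec_sum (num_squares_vec {Suc (trib (j + 3) + window (j + 2))..trib (j + 3) + window (j + 3)})
    (num_squares_vec {Suc (window (j + 2))..window (j + 3)})
    (replicate (nat (int (trib (j + 2)) - kernel_num (j + 4) + 1)) 0
      @ replicate (nat (kernel_num (j + 4) - 1)) 1)"
proof -
  note f = trib_window_facts[of j]
  have p: "nat (int (trib (j + 2)) - kernel_num (j + 4) + 1) = trib (j + 3) - Suc (window (j + 2))"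
    using f by linarith
  have q: "nat (kernel_num (j + 4) - 1) = Suc (window (j + 3)) - trib (j + 3)"
    using f by linarith
  have "num_squares_ending_at (trib (j + 3) + (Suc (window (j + 2)) + i)) =
    num_squares_ending_at (Suc (window (j + 2)) + i) + (if trib (j + 3) \<le> Suc (window (j + 2)) + i then 1 else 0)"
    if "i < window (j + 3) - window (j + 2)" for i
  proof -
    let ?i = "Suc (window (j + 2)) + i"
    have "window j < ?i" "?i \<le> window (j + 3)" "\<not> ?i < 2 * trib j" "\<not> ?i \<le> window (j + 2)"
      using that f by linarith+
    then show ?thesis using num_squares_shift[of j ?i] by (simp only: simp_thms)
  qed
  then show ?thesis unfolding p q
    using f(8,9) by (intro is_vec_sum_shift) (auto simp: nth_append)
qed

text \<open>In this range only the period \<open>trib (j + 1) + trib j\<close> can be new, and it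
  appears once \<open>i\<close> reaches that value.\<close>

lemma Gamma2_recurrence:
  "is_vec_sum (num_squares_vec {Suc (trib (j + 3) + window (j + 1))..trib (j + 3) + window (j + 2)})
    (num_squares_vec {Suc (window (j + 1))..window (j + 2)})
    (replicate (nat (int (trib (j + 1)) - kernel_num (j + 4) + 1)) 0
      @ replicate (nat (kernel_num (j + 4) - 1)) 1)"
proof -
  note f = trib_window_facts[of j]
  define l where "l = trib (j + 1) + trib j"
  have p: "nat (int (trib (j + 1)) - kernel_num (j + 4) + 1) = l - Suc (window (j + 1))"
    using f unfolding l_def by linarith
  have q: "nat (kernel_num (j + 4) - 1) = Suc (window (j + 2)) - l"
    using f unfolding l_def by linarith
  have l: "window (j + 1) < l" "l \<le> Suc (window (j + 2))" using f unfolding l_def by linarith+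
  have "num_squares_ending_at (trib (j + 3) + (Suc (window (j + 1)) + i)) =
    num_squares_ending_at (Suc (window (j + 1)) + i) + (if l \<le> Suc (window (j + 1)) + i then 1 else 0)"
    if "i < window (j + 2) - window (j + 1)" for i
  proof -
    let ?i = "Suc (window (j + 1)) + i"
    have "window j < ?i" "?i \<le> window (j + 3)" "\<not> ?i < 2 * trib j" "?i \<le> window (j + 2)"
      "\<not> trib (j + 3) \<le> ?i"
      using that f by linarith+
    then show ?thesis using num_squares_shift[of j ?i] by (simp only: l_def simp_thms)
  qed
  then show ?thesis unfolding p q
    using l by (intro is_vec_sum_shift) (auto simp: nth_append)
qed

text \<open>Here the new square has period \<open>trib j\<close> and is lost once \<open>i\<close>
  reaches \<open>2 * trib j\<close>, so the ones come first.\<close>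

lemma Gamma3_recurrence:
  "is_vec_sum (num_squares_vec {Suc (trib (j + 3) + window j)..trib (j + 3) + window (j + 1)})
    (num_squares_vec {Suc (window j)..window (j + 1)})
    (replicate (nat (int (trib j) - kernel_num (j + 1) + 1)) 1
      @ replicate (nat (kernel_num (j + 1) - 1)) 0)"
proof -
  note f = trib_window_facts[of j]
  have p: "nat (int (trib j) - kernel_num (j + 1) + 1) = 2 * trib j - Suc (window j)"
    using f by linarith
  have q: "nat (kernel_num (j + 1) - 1) = Suc (window (j + 1)) - 2 * trib j"
    using f by linarith
  have l: "window j < 2 * trib j" by (rule window_less_trib)
  have "num_squares_ending_at (trib (j + 3) + (Suc (window j) + i)) =
    num_squares_ending_at (Suc (window j) + i) + (if Suc (window j) + i < 2 * trib j then 1 else 0)"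
    if "i < window (j + 1) - window j" for i
  proof -
    let ?i = "Suc (window j) + i"
    have "window j < ?i" "?i \<le> window (j + 3)" "\<not> trib (j + 1) + trib j \<le> ?i"
      "\<not> trib (j + 3) \<le> ?i"
      using that f by linarith+
    then show ?thesis using num_squares_shift[of j ?i] by (simp only: simp_thms)
  qed
  then show ?thesis unfolding p q
    using l f(6) by (intro is_vec_sum_shift) (auto simp: nth_append)
qed

section \<open>Initial values and assembly\<close>

lemma trib_values: "trib 1 = 2" "trib 2 = 4" "trib 3 = 7" "trib 4 = 13" "trib 5 = 24"
  by (simp_all add: trib_init trib_rec eval_nat_numeral)

lemma window_values: "window 1 = 1" "window 2 = 3" "window 3 = 7" "window 4 = 14" "window 5 = 27"
  by (simp_all add: window_Suc trib_init trib_rec eval_nat_numeral)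

text \<open>The prefix of length 7 is abacaba, which contains no square.\<close>

lemma num_squares_initial: "n \<le> 7 \<Longrightarrow> num_squares_ending_at n = 0"
proof -
  assume n: "n \<le> 7"
  have "letter_at i = (sigma ^^ 3) [La] ! i" if "i < 7" for i
    using stake_nth[of i 7 tribonacci] stake_trib[of 3] that
    by (simp only: trib_values letter_at_def)
  then have letters: "letter_at 1 = Lb" "letter_at 2 = La" "letter_at 3 = Lc" "letter_at 4 = La"
    "letter_at 5 = Lb" "letter_at 6 = La"
    by (simp_all add: sigma_def eval_nat_numeral)
  have False if "l \<in> periods_at n" for l
  proof -
    obtain i where i: "n = i + 2 * l" "0 < l" "\<forall>j<l. letter_at (i + j) = letter_at (i + l + j)"
      using \<open>l \<in> periods_at n\<close> by (rule periods_atE)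
    have "l = 1 \<and> i \<in> {0, 1, 2, 3, 4, 5} \<or> l = 2 \<and> i \<in> {0, 1, 2, 3} \<or> l = 3 \<and> i \<in> {0, 1}"
      using i(1,2) n by (simp; presburger)
    moreover have "letter_at i = letter_at (i + l)" using i(2,3) by (metis add.right_neutral)
    moreover have "1 < l \<Longrightarrow> letter_at (i + 1) = letter_at (i + l + 1)" using i(3) by blast
    ultimately show False using letters by (auto simp: eval_nat_numeral)
  qed
  then have "periods_at n = {}" by blast
  then show "num_squares_ending_at n = 0" by (simp add: num_squares_ending_at_eq)
qed

theorem proposition3p1:
  shows "num_squares_vec {8} = [1]
    \<and> num_squares_vec {9..10} = [0, 1]
    \<and> num_squares_vec {11..14} = [0, 0, 0, 1]
    \<and> num_squares_vec {15..16} = [1, 1]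
    \<and> num_squares_vec {17..20} = [0, 0, 1, 1]
    \<and> num_squares_vec {28..31} = [1, 1, 1, 1]
    \<and> (\<forall>m\<ge>5. is_vec_sum (num_squares_vec (Gamma1 m))
          (num_squares_vec (Gamma3 (m - 1)) @ num_squares_vec (Gamma2 (m - 1))
             @ num_squares_vec (Gamma1 (m - 1)))
          (replicate (nat (int (trib (m - 2)) - kernel_num m + 1)) 0
             @ replicate (nat (kernel_num m - 1)) 1))
    \<and> (\<forall>m\<ge>6. is_vec_sum (num_squares_vec (Gamma2 m))
          (num_squares_vec (Gamma3 (m - 2)) @ num_squares_vec (Gamma2 (m - 2))
             @ num_squares_vec (Gamma1 (m - 2)))
          (replicate (nat (int (trib (m - 3)) - kernel_num m + 1)) 0
             @ replicate (nat (kernel_num m - 1)) 1))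
    \<and> (\<forall>m\<ge>7. is_vec_sum (num_squares_vec (Gamma3 m))
          (num_squares_vec (Gamma3 (m - 3)) @ num_squares_vec (Gamma2 (m - 3))
             @ num_squares_vec (Gamma1 (m - 3)))
          (replicate (nat (int (trib (m - 4)) - kernel_num (m - 3) + 1)) 1
             @ replicate (nat (kernel_num (m - 3) - 1)) 0))"
proof -
  \<comment> \<open>\<open>num_squares_shift\<close> with \<open>j\<close> equal to 0, 1 and 2 gives
    the shifts 7, 13 and 24. All \<open>i\<close> used are at most 7, where the count is 0.\<close>
  have first: "num_squares_ending_at (7 + i) =
      (if i < 2 \<or> i = 3 \<or> i = 7 then 1 else 0)" if "1 \<le> i" "i \<le> 7" for i
    using num_squares_shift[of 0 i] num_squares_initial[of i] that
    by (auto simp: trib_values window_values trib_init trib_rec window_Suc)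
  have second: "num_squares_ending_at (13 + i) = num_squares_ending_at i +
      (if i < 4 \<or> 6 \<le> i then 1 else 0)" if "2 \<le> i" "i \<le> 7" for i
    using num_squares_shift[of 1 i] that
    by (auto simp: trib_values window_values trib_init trib_rec window_Suc)
  have third: "num_squares_ending_at (24 + i) = num_squares_ending_at i + 1" if "4 \<le> i" "i \<le> 7" for i
    using num_squares_shift[of 2 i] that
    by (auto simp: trib_values window_values trib_init trib_rec window_Suc)
  have initial: "map num_squares_ending_at [8, 9, 10, 11, 12, 13, 14] = [1, 0, 1, 0, 0, 0, 1]"
    "map num_squares_ending_at [15, 16, 17, 18, 19, 20] = [1, 1, 0, 0, 1, 1]"
    "map num_squares_ending_at [28, 29, 30, 31] = [1, 1, 1, 1]"
    using first[of 1] first[of 2] first[of 3] first[of 4] first[of 5] first[of 6] first[of 7]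
      second[of 2] second[of 3] second[of 4] second[of 5] second[of 6] second[of 7]
      third[of 4] third[of 5] third[of 6] third[of 7] num_squares_initial
    by simp_all
  have intervals: "sorted_list_of_set {9..10::nat} = [9, 10]"
    "sorted_list_of_set {11..14::nat} = [11, 12, 13, 14]"
    "sorted_list_of_set {15..16::nat} = [15, 16]"
    "sorted_list_of_set {17..20::nat} = [17, 18, 19, 20]"
    "sorted_list_of_set {28..31::nat} = [28, 29, 30, 31]"
    by (simp_all add: upt_rec flip: atLeastLessThanSuc_atLeastAtMost)
  have g1: "is_vec_sum (num_squares_vec (Gamma1 m))
          (num_squares_vec (Gamma3 (m - 1)) @ num_squares_vec (Gamma2 (m - 1))
             @ num_squares_vec (Gamma1 (m - 1)))
          (replicate (nat (int (trib (m - 2)) - kernel_num m + 1)) 0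
             @ replicate (nat (kernel_num m - 1)) 1)" if "5 \<le> m" for m
  proof -
    define j where "j = m - 4"
    have m: "m = j + 4" "m - 1 = j + 3" "m - 2 = j + 2" "4 \<le> j + 3" "4 \<le> j + 4"
      "j + 3 - 1 = j + 2" "j + 4 - 1 = j + 3" "j + 4 - 2 = j + 2"
      using that by (simp_all add: j_def)
    show ?thesis
      unfolding m(2,3) num_squares_vec_Gamma[OF m(4)] m(6) unfolding m(1) Gamma_eq[OF m(5)] m(7,8)
        trib_window_facts(5)
      using Gamma1_recurrence[of j] by (simp only: trib_window_facts(5))
  qed
  have g2: "is_vec_sum (num_squares_vec (Gamma2 m))
          (num_squares_vec (Gamma3 (m - 2)) @ num_squares_vec (Gamma2 (m - 2))
             @ num_squares_vec (Gamma1 (m - 2)))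
          (replicate (nat (int (trib (m - 3)) - kernel_num m + 1)) 0
             @ replicate (nat (kernel_num m - 1)) 1)" if "6 \<le> m" for m
  proof -
    define j where "j = m - 4"
    have m: "m = j + 4" "m - 2 = j + 2" "m - 3 = j + 1" "4 \<le> j + 2" "4 \<le> j + 4"
      "j + 2 - 1 = j + 1" "j + 4 - 1 = j + 3" "j + 4 - 2 = j + 2" "j + 4 - 3 = j + 1"
      using that by (simp_all add: j_def)
    show ?thesis
      unfolding m(2,3) num_squares_vec_Gamma[OF m(4)] m(6) unfolding m(1) Gamma_eq[OF m(5)] m(7-9)
      by (rule Gamma2_recurrence)
  qed
  have g3: "is_vec_sum (num_squares_vec (Gamma3 m))
          (num_squares_vec (Gamma3 (m - 3)) @ num_squares_vec (Gamma2 (m - 3))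
             @ num_squares_vec (Gamma1 (m - 3)))
          (replicate (nat (int (trib (m - 4)) - kernel_num (m - 3) + 1)) 1
             @ replicate (nat (kernel_num (m - 3) - 1)) 0)" if "7 \<le> m" for m
  proof -
    define j where "j = m - 4"
    have m: "m = j + 4" "m - 3 = j + 1" "m - 4 = j" "4 \<le> j + 1" "4 \<le> j + 4"
      "j + 1 - 1 = j" "j + 4 - 1 = j + 3" "j + 4 - 3 = j + 1"
      using that by (simp_all add: j_def)
    \<comment> \<open>Brings the left end of \<open>Gamma3 m\<close> into the shifted form of
      \<open>Gamma3_recurrence\<close>.\<close>
    have "window (j + 3) = trib (j + 3) + window j"
      using trib_window_facts(1-4)[of j] by linarith
    then show ?thesis
      unfolding m(2,3) num_squares_vec_Gamma[OF m(4)] m(6) unfolding m(1) Gamma_eq[OF m(5)] m(7,8)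
      using Gamma3_recurrence[of j] by (simp only:)
  qed
  show ?thesis
    using initial g1 g2 g3 unfolding num_squares_vec_def intervals by (simp add: num_squares_vec_def)
qed

end
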